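(* Let $S=\{x_1,\dots,x_n\}$ be a set of $n$ distinct positive integers which is gcd closed, satisfies the condition $\mathcal G$, and has $\max_{x\in S}|G_S(x)|=3$. Let $a$ and $b$ be positive integers with $a\mid b$. Then the $a$-th power LCM matrix $[S^a]$ divides the $b$-th power LCM matrix $[S^b]$ in the ring $M_n(\mathbb Z)$.
   Context: For integers $x,y$, $(x,y)$ and $[x,y]$ denote their gcd and lcm. $S$ is gcd closed if $(x_i,x_j)\in S$ for all $1\le i,j\le n$. For $x,y\in S$ with $x<y$, $x$ is a greatest-type divisor of $y$ in $S$ if $x\mid y$ and the conditions $x\mid d\mid y$, $d\in S$ imply $d\in\{x,y\}$; $G_S(y)$ denotes the set of greatest-type divisors of $y$ in $S$. For $x\in S$ with $|G_S(x)|\ge2$, two distinct $y_1,y_2\in G_S(x)$ satisfy the condition $\mathcal G$ if $[y_1,y_2]=x$ and $(y_1,y_2)\in G_S(y_1)\cap G_S(y_2)$; $x$ satisfies $\mathcal G$ if any two distinct elements of $G_S(x)$ satisfy $\mathcal G$; $S$ satisfies $\mathcal G$ if every $x\in S$ has either $|G_S(x)|\le1$, or $|G_S(x)|\ge2$ and $x$ satisfies $\mathcal G$. $[S^a]$ is the $n\times n$ matrix with $(i,j)$-entry $[x_i,x_j]^a$. A matrix $A$ divides $B$ in $M_n(\mathbb Z)$ if there is $C\in M_n(\mathbb Z)$ with $B=AC$ or $B=CA$. *)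

theory Defs
  imports Jordan_Normal_Form.Matrix
begin

definition gcd_closed :: "nat set \<Rightarrow> bool" where
  "gcd_closed S \<longleftrightarrow> (\<forall>x\<in>S. \<forall>y\<in>S. gcd x y \<in> S)"

definition greatest_type_divisor :: "nat set \<Rightarrow> nat \<Rightarrow> nat \<Rightarrow> bool" where
  "greatest_type_divisor S x y \<longleftrightarrow>
     x \<in> S \<and> y \<in> S \<and> x < y \<and> x dvd y \<and>
     (\<forall>d\<in>S. x dvd d \<and> d dvd y \<longrightarrow> d \<in> {x, y})"

definition greatest_type_divisors :: "nat set \<Rightarrow> nat \<Rightarrow> nat set" where
  "greatest_type_divisors S y = {x. greatest_type_divisor S x y}"

definition pair_satisfies_G :: "nat set \<Rightarrow> nat \<Rightarrow> nat \<Rightarrow> nat \<Rightarrow> bool" where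
  "pair_satisfies_G S x y1 y2 \<longleftrightarrow>
     lcm y1 y2 = x \<and>
     gcd y1 y2 \<in> greatest_type_divisors S y1 \<inter> greatest_type_divisors S y2"

definition elem_satisfies_G :: "nat set \<Rightarrow> nat \<Rightarrow> bool" where
  "elem_satisfies_G S x \<longleftrightarrow>
     (\<forall>y1\<in>greatest_type_divisors S x. \<forall>y2\<in>greatest_type_divisors S x.
        y1 \<noteq> y2 \<longrightarrow> pair_satisfies_G S x y1 y2)"

(* Intended for finite S, since card of an infinite set is 0. *)
definition satisfies_G :: "nat set \<Rightarrow> bool" where
  "satisfies_G S \<longleftrightarrow>
     (\<forall>x\<in>S. card (greatest_type_divisors S x) \<le> 1 \<or>
        (card (greatest_type_divisors S x) \<ge> 2 \<and> elem_satisfies_G S x))"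

(* The elements of S are listed as x 0, ..., x (n - 1); row and column indices start at 0. *)
definition power_lcm_mat :: "nat \<Rightarrow> (nat \<Rightarrow> nat) \<Rightarrow> nat \<Rightarrow> int mat" where
  "power_lcm_mat n x a = mat n n (\<lambda>(i, j). int (lcm (x i) (x j)) ^ a)"

(* Two-sided disjunction: the cofactor may stand on either side, as the ring is not commutative. *)
definition int_mat_divides :: "nat \<Rightarrow> int mat \<Rightarrow> int mat \<Rightarrow> bool" where
  "int_mat_divides n A B \<longleftrightarrow>
     A \<in> carrier_mat n n \<and> B \<in> carrier_mat n n \<and>
     (\<exists>C\<in>carrier_mat n n. B = A * C \<or> B = C * A)"

end

theory Submission
  imports Defs Complex_Main
begin

text \<open>
  For \<open>m \<in> S\<close> the ratios \<open>p\<^sub>y = m / y\<close>, with \<open>y\<close> a greatest-type divisor of \<open>m\<close>, are pairwise coprime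
  by condition \<open>\<G>\<close>, so for every set \<open>I\<close> of such \<open>y\<close> the element \<open>m\<^sub>I = m / (\<Prod>y\<in>I. p\<^sub>y)\<close>, being the
  gcd of \<open>m\<close> and \<open>I\<close>, lies in \<open>S\<close>. If moreover \<open>v \<in> S\<close> divides \<open>m\<close>, then \<open>gcd v y\<close> is \<open>v\<close> or \<open>v / p\<^sub>y\<close>
  and nothing in between. Hence alternating sums over \<open>I\<close> factor: writing \<open>\<pi> m = (\<Prod>y. 1 - p\<^sub>y ^ a)\<close>,
  the sum of \<open>(-1) ^ card I * (\<Prod>y\<in>I. p\<^sub>y) ^ a\<close> times row \<open>m\<^sub>I\<close> of the \<open>a\<close>-th power LCM matrix is the row
  with entry \<open>w ^ a * \<pi> m\<close> at the multiples \<open>w\<close> of \<open>m\<close> and \<open>0\<close> elsewhere. On the other hand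
  \<open>h w = lcm u w ^ b / w ^ a\<close> is a sum over \<open>m dvd w\<close> of the Moebius terms
  \<open>\<Sum>I. (-1) ^ card I * h m\<^sub>I = h m * (\<Prod>y. 1 - t\<^sub>y)\<close>, where \<open>t\<^sub>y\<close> is \<open>p\<^sub>y ^ a\<close> or, if \<open>gcd u m dvd y\<close>,
  \<open>1 / p\<^sub>y ^ (b - a)\<close>. As \<open>p\<^sub>y ^ a - 1\<close> divides \<open>p\<^sub>y ^ (b - a) - 1\<close>, each term is an integer multiple of
  \<open>\<pi> m\<close>, and every row of the \<open>b\<close>-th power matrix is an integer combination of rows of the \<open>a\<close>-th.
\<close>

section \<open>Alternating sums over subsets, and meets\<close>

lemma sum_Pow_alternating_prod:
  fixes t :: "'a \<Rightarrow> real"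
  assumes "finite A"
  shows "(\<Sum>I\<in>Pow A. (-1) ^ card I * prod t I) = (\<Prod>y\<in>A. 1 - t y)"
  using prod_diff_conv_sum[OF assms, of "\<lambda>_. 1" t] by simp

text \<open>Taking the gcd with \<open>m\<close> gives the value \<open>m\<close> for empty \<open>I\<close>, where \<open>Gcd {} = 0\<close>.\<close>

definition meet_with :: "nat \<Rightarrow> nat set \<Rightarrow> nat" where
  "meet_with m I = gcd m (Gcd I)"

lemma meet_with_empty [simp]: "meet_with m {} = m"
  by (simp add: meet_with_def)

lemma dvd_meet_with_iff: "d dvd meet_with m I \<longleftrightarrow> d dvd m \<and> (\<forall>y\<in>I. d dvd y)"
  by (auto simp: meet_with_def dvd_Gcd_iff)

definition ratio :: "nat \<Rightarrow> nat \<Rightarrow> real" where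
  "ratio m y = real (m div y)"

text \<open>For \<open>u\<close>, \<open>m\<close> in \<open>S\<close> and \<open>y\<close> a
  greatest-type divisor of \<open>m\<close>, this is \<open>gcd u m / gcd u y\<close>, by
  \<open>gcd_G_ratio\<close> below.\<close>

definition gcd_ratio :: "nat \<Rightarrow> nat \<Rightarrow> nat \<Rightarrow> real" where
  "gcd_ratio u m y = (if gcd u m dvd y then 1 else ratio m y)"

locale G_set =
  fixes S :: "nat set"
  assumes finite_S: "finite S"
    and zero_notin: "0 \<notin> S"
    and gcd_closed_S: "gcd_closed S"
    and satisfies_G_S: "satisfies_G S"
begin

section \<open>Greatest-type divisors under the condition on pairs\<close>

abbreviation "G \<equiv> greatest_type_divisors S"

lemma finite_G: "finite (G m)"
  by (rule finite_subset[OF _ finite_S])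
    (auto simp: greatest_type_divisors_def greatest_type_divisor_def)

lemma S_pos: "m \<in> S \<Longrightarrow> m > 0"
  using zero_notin by (cases m) auto

lemma gcd_in: "v \<in> S \<Longrightarrow> w \<in> S \<Longrightarrow> gcd v w \<in> S"
  using gcd_closed_S by (auto simp: gcd_closed_def)

lemma G_D:
  assumes "y \<in> G m"
  shows "y \<in> S" "m \<in> S" "y < m" "y dvd m"
  using assms by (auto simp: greatest_type_divisors_def greatest_type_divisor_def)

lemma G_ratio:
  assumes "y \<in> G m"
  shows "(m div y) * y = m" "m div y > 1"
proof -
  show *: "(m div y) * y = m" using G_D[OF assms] by simp
  show "m div y > 1"
  proof (rule ccontr)
    assume "\<not> m div y > 1"
    then have "m div y = 0 \<or> m div y = 1" by linarith
    with * G_D(3)[OF assms] show False by auto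
  qed
qed

lemma G_distinct:
  assumes "y \<in> G m" "z \<in> G m" "y \<noteq> z"
  shows "lcm y z = m" "gcd y z \<in> G y" "gcd y z \<in> G z"
proof -
  have "card {y, z} \<le> card (G m)"
    using assms by (intro card_mono finite_G) auto
  then have "card (G m) \<ge> 2" using assms by simp
  then have "elem_satisfies_G S m"
    using satisfies_G_S G_D(2)[OF assms(1)] by (auto simp: satisfies_G_def)
  then have "pair_satisfies_G S m y z"
    using assms by (auto simp: elem_satisfies_G_def)
  then show "lcm y z = m" "gcd y z \<in> G y" "gcd y z \<in> G z"
    by (auto simp: pair_satisfies_G_def)
qed

text \<open>If \<open>d\<close> divides both ratios, then \<open>y * d\<close> and
  \<open>z * d\<close> divide \<open>m\<close>, hence so does their lcm, which is
  \<open>m * d\<close>.\<close>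

lemma G_ratio_coprime:
  assumes "y \<in> G m" "z \<in> G m" "y \<noteq> z"
  shows "coprime (m div y) (m div z)"
proof (rule coprimeI)
  fix d assume d: "d dvd m div y" "d dvd m div z"
  have m: "m > 0" using G_D[OF assms(1)] S_pos by auto
  have "y * d dvd m" "z * d dvd m"
    using d G_ratio(1)[OF assms(1)] G_ratio(1)[OF assms(2)]
    by (metis mult.commute mult_dvd_mono dvd_refl)+
  then have "lcm (y * d) (z * d) dvd m" by simp
  then have "m * d dvd m"
    using G_distinct(1)[OF assms] by (simp add: lcm_mult_right lcm.commute[of z y])
  with m show "is_unit d" by (metis dvd_times_right_cancel_iff mult.right_neutral mult.commute neq0_conv)
qed

text \<open>The numerically largest proper divisor of \<open>m\<close> in \<open>S\<close> above
  \<open>w\<close> leaves no room for an element in between.\<close>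

lemma ex_G_between:
  assumes "w \<in> S" "m \<in> S" "w dvd m" "w \<noteq> m"
  shows "\<exists>y\<in>G m. w dvd y"
proof -
  define D where "D = {d \<in> S. w dvd d \<and> d dvd m \<and> d \<noteq> m}"
  have D: "finite D" "w \<in> D" using assms finite_S by (auto simp: D_def)
  define y where "y = Max D"
  have y: "y \<in> D" using D by (auto simp: y_def intro: Max_in)
  have "d = y" if "d \<in> S" "y dvd d" "d dvd m" "d \<noteq> m" for d
  proof -
    have "w dvd d" using y that dvd_trans unfolding D_def by blast
    then have "d \<in> D" using that by (auto simp: D_def)
    then have "d \<le> y" using D by (auto simp: y_def)
    moreover have "y \<le> d" using that S_pos[of d] by (auto intro: dvd_imp_le)
    ultimately show ?thesis by simp
  qed
  moreover have "y < m"
    using y S_pos[OF assms(2)] by (auto simp: D_def intro: le_neq_trans dvd_imp_le)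
  ultimately have "y \<in> G m"
    using y assms by (auto simp: greatest_type_divisors_def greatest_type_divisor_def D_def)
  with y show ?thesis by (auto simp: D_def)
qed

text \<open>Descent on \<open>m\<close>: a proper divisor \<open>w\<close> lies below some other
  \<open>z\<close> in \<open>G m\<close>. The condition puts \<open>gcd y z\<close> in
  \<open>G z\<close>, and \<open>lcm y z = m\<close> makes its ratio to \<open>z\<close> equal to
  that of \<open>y\<close> to \<open>m\<close>, so the claim for \<open>z\<close> and
  \<open>gcd y z\<close> is the claim for \<open>m\<close> and \<open>y\<close>.\<close>

lemma gcd_G_ratio:
  assumes "y \<in> G m" "w \<in> S" "w dvd m" "\<not> w dvd y"
  shows "gcd w y * (m div y) = w"
  using assms
proof (induction m arbitrary: y rule: less_induct)
  case (less m)
  show ?case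
  proof (cases "w = m")
    case True
    then show ?thesis using G_D[OF less.prems(1)] G_ratio(1)[OF less.prems(1)]
      by (simp add: gcd_nat.absorb2 mult.commute)
  next
    case False
    then obtain z where z: "z \<in> G m" "w dvd z"
      using ex_G_between less.prems G_D(2) by blast
    with less.prems have "y \<noteq> z" by auto
    note yz = G_distinct[OF less.prems(1) z(1) this]
    have "\<not> w dvd gcd y z" using less.prems by auto
    with less.IH[of z "gcd y z"] yz z G_D[OF z(1)] less.prems
    have IH: "gcd w (gcd y z) * (z div gcd y z) = w" by blast
    have "gcd w (gcd y z) = gcd w y"
      using z(2) by (metis gcd.assoc gcd.commute gcd_nat.absorb1)
    moreover have "z div gcd y z = m div y"
    proof -
      have "y > 0" using G_D(1)[OF less.prems(1)] S_pos by blast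
      have "y * z = m * gcd y z"
        using yz(1) prod_gcd_lcm_nat[of y z] by (simp add: mult.commute)
      moreover have "z = (z div gcd y z) * gcd y z" by simp
      moreover have "m = (m div y) * y" using G_ratio(1)[OF less.prems(1)] by simp
      ultimately have "y * gcd y z * (z div gcd y z) = y * gcd y z * (m div y)"
        by (metis mult.assoc mult.commute)
      then show ?thesis using \<open>y > 0\<close> by simp
    qed
    ultimately show ?thesis using IH by simp
  qed
qed

section \<open>Meets of several greatest-type divisors\<close>

lemma meet_with_in:
  assumes "m \<in> S" "I \<subseteq> G m"
  shows "meet_with m I \<in> S"
proof -
  have "finite I" using assms finite_G finite_subset by blast
  then show ?thesis using assms(2)
  proof induction
    case empty
    then show ?case using assms by simp
  next
    case (insert y I)
    have "meet_with m (insert y I) = gcd y (meet_with m I)"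
      by (simp add: meet_with_def gcd.left_commute)
    then show ?case using insert gcd_in[of y "meet_with m I"] G_D(1)[of y m] by simp
  qed
qed

text \<open>Each single \<open>y\<close> removes from \<open>v\<close> either nothing or the ratio
  \<open>m div y\<close>; coprimality of the ratios makes these removals independent.\<close>

lemma gcd_meet:
  assumes "m \<in> S" "v \<in> S" "v dvd m" "I \<subseteq> G m"
  shows "gcd v (meet_with m I) * (\<Prod>y\<in>I. if v dvd y then 1 else m div y) = v"
proof -
  let ?q = "\<lambda>y. if v dvd y then 1 else m div y"
  have "finite I" using assms finite_G finite_subset by blast
  then show ?thesis using assms(4)
  proof induction
    case empty
    then show ?case using assms by (simp add: gcd_nat.absorb1)
  next
    case (insert y I)
    let ?P = "prod ?q I" and ?v = "gcd v (meet_with m I)" and ?e = "gcd v y"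
    have y: "y \<in> G m" using insert by simp
    have IH: "?v * ?P = v" using insert by simp
    have e: "?e * ?q y = v"
      using gcd_G_ratio[OF y assms(2,3)] by (auto simp: gcd_nat.absorb1)
    have "coprime (?q y) (?q z)" if "z \<in> I" for z
      using G_ratio_coprime[OF y, of z] that insert by auto
    then have cop: "coprime (?q y) ?P" by (intro prod_coprime_right)
    have "gcd v (meet_with m (insert y I)) = gcd ?v ?e"
      by (simp add: meet_with_def gcd.assoc gcd.commute gcd.left_commute)
    \<comment> \<open>Scaling by \<open>?q y * ?P\<close> turns the two arguments into
      \<open>v * ?q y\<close> and \<open>v * ?P\<close>, whose gcd is \<open>v\<close> by
      coprimality.\<close>
    then have "gcd v (meet_with m (insert y I)) * (?q y * ?P) = gcd (?v * (?q y * ?P)) (?e * (?q y * ?P))"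
      using gcd_mult_distrib_nat[of "?q y * ?P" ?v ?e] by (simp only: mult.commute)
    also have "\<dots> = gcd ((?v * ?P) * ?q y) ((?e * ?q y) * ?P)" by (simp only: mult_ac)
    also have "\<dots> = gcd (v * ?q y) (v * ?P)" by (simp only: IH e)
    also have "\<dots> = v * gcd (?q y) ?P" by (simp only: gcd_mult_distrib_nat)
    also have "\<dots> = v" using cop by (simp only: coprime_iff_gcd_eq_1 mult_1_right)
    finally show ?case unfolding prod.insert[OF insert.hyps] .
  qed
qed

lemma meet_mult:
  assumes "m \<in> S" "I \<subseteq> G m"
  shows "meet_with m I * (\<Prod>y\<in>I. m div y) = m"
proof -
  have "(\<Prod>y\<in>I. if m dvd y then 1 else m div y) = (\<Prod>y\<in>I. m div y)"
  proof (rule prod.cong)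
    fix y assume "y \<in> I"
    then have "y \<in> G m" using assms by auto
    then have "\<not> m dvd y" using G_D[of y m] S_pos[of y] by (auto dest: dvd_imp_le)
    then show "(if m dvd y then 1 else m div y) = m div y" by simp
  qed simp
  then show ?thesis
    using gcd_meet[OF assms(1,1) _ assms(2)] by (simp add: meet_with_def)
qed

lemma ratio_gt_1: "y \<in> G m \<Longrightarrow> ratio m y > 1"
  using G_ratio(2)[of y m] by (simp add: ratio_def)

lemma meet_eq:
  assumes "m \<in> S" "I \<subseteq> G m"
  shows "real (meet_with m I) = real m / prod (ratio m) I"
proof -
  have "ratio m y > 0" if "y \<in> I" for y using ratio_gt_1[of y m] assms that by force
  then have "prod (ratio m) I > 0" by (intro prod_pos)
  moreover have "real (meet_with m I) * prod (ratio m) I = real m"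
    using arg_cong[OF meet_mult[OF assms], of real] by (simp add: ratio_def)
  ultimately show ?thesis by (simp add: field_simps)
qed

text \<open>Compare \<open>lcm * gcd = product\<close> for the pairs \<open>u\<close>,
  \<open>m\<close> and \<open>u\<close>, \<open>meet_with m I\<close>: the gcd shrinks by the
  product of the \<open>gcd_ratio\<close>, the second member by the product of the
  \<open>ratio\<close>.\<close>

lemma lcm_meet:
  assumes "u \<in> S" "m \<in> S" "I \<subseteq> G m"
  shows "real (lcm u (meet_with m I)) = real (lcm u m) * (\<Prod>y\<in>I. gcd_ratio u m y / ratio m y)"
proof -
  let ?v = "gcd u m" and ?z = "meet_with m I"
  let ?P = "prod (ratio m) I" and ?Q = "prod (gcd_ratio u m) I"
  have "?v \<in> S" using assms gcd_in by simp
  have pos: "?v > 0" "gcd u ?z > 0" using S_pos[OF assms(1)] by auto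
  have "gcd ?v ?z = gcd u ?z" by (simp add: meet_with_def gcd.assoc)
  then have "gcd u ?z * (\<Prod>y\<in>I. if ?v dvd y then 1 else m div y) = ?v"
    using gcd_meet[OF assms(2) \<open>?v \<in> S\<close> _ assms(3)] by simp
  moreover have "real (\<Prod>y\<in>I. if ?v dvd y then 1 else m div y) = ?Q"
    unfolding gcd_ratio_def ratio_def of_nat_prod by (intro prod.cong) auto
  ultimately have Q: "real (gcd u ?z) * ?Q = real ?v"
    by (metis of_nat_mult)
  have "real (lcm u ?z) * real (gcd u ?z) = real u * real ?z"
    by (metis mult.commute of_nat_mult prod_gcd_lcm_nat)
  also have "\<dots> = real u * real m / ?P" by (simp add: meet_eq[OF assms(2,3)])
  also have "real u * real m = real (lcm u m) * real ?v"
    by (metis mult.commute of_nat_mult prod_gcd_lcm_nat)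
  also have "real ?v = real (gcd u ?z) * ?Q" by (simp only: Q)
  finally have "real (lcm u ?z) * real (gcd u ?z) = (real (lcm u m) * (?Q / ?P)) * real (gcd u ?z)"
    by (simp add: mult_ac)
  with pos have "real (lcm u ?z) = real (lcm u m) * (?Q / ?P)"
    by (subst (asm) mult_right_cancel) auto
  then show ?thesis by (simp add: prod_dividef)
qed

section \<open>Moebius expansion over the divisors in \<open>S\<close>\<close>

lemma sum_divisors_alternating:
  fixes h :: "nat \<Rightarrow> real"
  assumes "w \<in> S"
  shows "h w = (\<Sum>m\<in>{m\<in>S. m dvd w}. \<Sum>I\<in>Pow (G m). (-1) ^ card I * h (meet_with m I))"
  using assms
proof (induction w rule: less_induct)
  case (less w)
  define g where "g m = (\<Sum>I\<in>Pow (G m). (-1) ^ card I * h (meet_with m I))" for m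
  define D where "D = {m\<in>S. m dvd w \<and> m \<noteq> w}"
  \<comment> \<open>By induction \<open>H I\<close> is \<open>h (meet_with w I)\<close> for nonempty
    \<open>I\<close>, whereas \<open>H {}\<close> is the sum of \<open>g\<close> over all proper
    divisors. The two families thus differ at \<open>I = {}\<close> only.\<close>
  define H where "H I = (\<Sum>d\<in>D. g d * (\<Prod>y\<in>I. of_bool (d dvd y)))" for I
  have D: "finite D" "w \<notin> D" "{m\<in>S. m dvd w} = insert w D"
    using finite_S less.prems by (auto simp: D_def)
  have H: "H I = h (meet_with w I)" if I: "I \<subseteq> G w" "I \<noteq> {}" for I
  proof -
    obtain y where y: "y \<in> I" "y \<in> G w" using I by auto
    have "meet_with w I dvd y" using y dvd_meet_with_iff[of "meet_with w I" w I] by auto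
    then have "meet_with w I < w"
      using dvd_imp_le[of "meet_with w I" y] G_D[OF y(2)] S_pos[of y] by auto
    then have h_sum: "h (meet_with w I) = (\<Sum>d\<in>{d\<in>S. d dvd meet_with w I}. g d)"
      using less.IH meet_with_in[OF less.prems I(1)] by (simp add: g_def)
    have "\<not> w dvd y" using G_D[OF y(2)] S_pos[of y] by (auto dest: dvd_imp_le)
    \<comment> \<open>As \<open>I\<close> is nonempty, \<open>w\<close> itself does not divide the
      meet, so restricting to \<open>D\<close> loses no divisor.\<close>
    then have D_eq: "{d\<in>S. d dvd meet_with w I} = {d\<in>D. \<forall>y\<in>I. d dvd y}"
      using y by (auto simp: D_def dvd_meet_with_iff)
    note h_sum
    also note D_eq
    also have "(\<Sum>d\<in>\<dots>. g d) = (\<Sum>d\<in>D. g d * of_bool (\<forall>y\<in>I. d dvd y))"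
      using D by (intro sum.mono_neutral_cong_left) auto
    also have "\<dots> = H I" unfolding H_def
    proof (intro sum.cong arg_cong2[of _ _ _ _ "(*)"] refl)
      fix d
      have "finite I" using I finite_G finite_subset by blast
      then show "of_bool (\<forall>y\<in>I. d dvd y) = (\<Prod>y\<in>I. of_bool (d dvd y) :: real)"
        by induction auto
    qed
    finally show ?thesis by simp
  qed
  have "(\<Sum>I\<in>Pow (G w). (-1) ^ card I * H I)
      = (\<Sum>d\<in>D. g d * (\<Sum>I\<in>Pow (G w). (-1) ^ card I * (\<Prod>y\<in>I. of_bool (d dvd y))))"
    unfolding H_def sum_distrib_left by (subst sum.swap) (simp add: mult_ac)
  also have "\<dots> = (\<Sum>d\<in>D. g d * (\<Prod>y\<in>G w. 1 - of_bool (d dvd y)))"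
    by (simp only: sum_Pow_alternating_prod[OF finite_G])
  also have "\<dots> = 0"
  proof (intro sum.neutral ballI)
    \<comment> \<open>Every proper divisor lies below some \<open>y\<close> in \<open>G w\<close>,
      which contributes a zero factor.\<close>
    fix d assume "d \<in> D"
    then obtain y where "y \<in> G w" "d dvd y"
      using ex_G_between less.prems by (auto simp: D_def)
    then have "(\<Prod>y\<in>G w. 1 - of_bool (d dvd y) :: real) = 0"
      using finite_G by (intro prod_zero) auto
    then show "g d * (\<Prod>y\<in>G w. 1 - of_bool (d dvd y)) = 0" by simp
  qed
  finally have H0: "(\<Sum>I\<in>Pow (G w). (-1) ^ card I * H I) = 0" .
  have "g w = (\<Sum>I\<in>Pow (G w). (-1) ^ card I * (h (meet_with w I) - H I))"
    using H0 by (simp add: g_def right_diff_distrib sum_subtractf)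
  also have "\<dots> = (\<Sum>I\<in>{{}}. (-1) ^ card I * (h (meet_with w I) - H I))"
    using H finite_G by (intro sum.mono_neutral_right) auto
  also have "\<dots> = h w - sum g D" by (simp add: H_def)
  finally show ?case using D by (simp add: g_def)
qed

section \<open>Integer combinations of rows of the \<open>a\<close>-th power matrix\<close>

text \<open>Rows are real functions, constrained on \<open>S\<close> only, so that the fractions
  \<open>h\<close> can be used; integrality is kept in the coefficients.\<close>

definition row_span :: "nat \<Rightarrow> (nat \<Rightarrow> real) set" where
  "row_span a = {f. \<exists>c :: nat \<Rightarrow> int. \<forall>w\<in>S. f w = (\<Sum>z\<in>S. of_int (c z) * real (lcm z w) ^ a)}"

lemma row_in_row_span:
  assumes "z \<in> S"
  shows "(\<lambda>w. real (lcm z w) ^ a) \<in> row_span a"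
  unfolding row_span_def
  using assms finite_S
  by (auto intro!: exI[of _ "\<lambda>y. of_bool (y = z)"] simp: of_bool_def if_distrib if_distribR cong: if_cong)

lemma row_span_scale:
  assumes "f \<in> row_span a" "k \<in> \<int>"
  shows "(\<lambda>w. k * f w) \<in> row_span a"
proof -
  from assms obtain c j where
    "\<And>w. w \<in> S \<Longrightarrow> f w = (\<Sum>z\<in>S. of_int (c z) * real (lcm z w) ^ a)" "k = of_int j"
    by (auto simp: row_span_def Ints_def)
  then show ?thesis unfolding row_span_def
    by (auto intro!: exI[of _ "\<lambda>z. j * c z"] simp: sum_distrib_left mult.assoc)
qed

lemma row_span_sum:
  assumes "finite A" "\<And>i. i \<in> A \<Longrightarrow> f i \<in> row_span a"
  shows "(\<lambda>w. \<Sum>i\<in>A. f i w) \<in> row_span a"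
  using assms
proof induction
  case empty
  then show ?case unfolding row_span_def by (auto intro!: exI[of _ "\<lambda>_. 0"])
next
  case (insert i A)
  then have "f i \<in> row_span a" "(\<lambda>w. \<Sum>i\<in>A. f i w) \<in> row_span a" by auto
  then obtain c d where
    "\<And>w. w \<in> S \<Longrightarrow> f i w = (\<Sum>z\<in>S. of_int (c z) * real (lcm z w) ^ a)"
    "\<And>w. w \<in> S \<Longrightarrow> (\<Sum>i\<in>A. f i w) = (\<Sum>z\<in>S. of_int (d z) * real (lcm z w) ^ a)"
    unfolding row_span_def by blast
  with insert show ?case unfolding row_span_def
    by (auto intro!: exI[of _ "\<lambda>z. c z + d z"] simp: sum.distrib distrib_right)
qed

lemma upward_row_in_row_span:
  assumes "m \<in> S"
  shows "(\<lambda>w. \<Sum>I\<in>Pow (G m). (-1) ^ card I * prod (ratio m) I ^ a * real (lcm (meet_with m I) w) ^ a)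
    \<in> row_span a"
proof (intro row_span_sum row_span_scale row_in_row_span)
  fix I assume "I \<in> Pow (G m)"
  then show "meet_with m I \<in> S" using assms meet_with_in by simp
  show "(-1) ^ card I * prod (ratio m) I ^ a \<in> \<int>"
    by (auto simp: ratio_def intro!: Ints_mult Ints_power Ints_prod)
qed (simp add: finite_G)

lemma upward_row_eq:
  assumes "m \<in> S" "w \<in> S" "a > 0"
  shows "(\<Sum>I\<in>Pow (G m). (-1) ^ card I * prod (ratio m) I ^ a * real (lcm (meet_with m I) w) ^ a)
    = (if m dvd w then real w ^ a * (\<Prod>y\<in>G m. 1 - ratio m y ^ a) else 0)"
proof -
  have "prod (ratio m) I ^ a * real (lcm (meet_with m I) w) ^ a
      = real (lcm w m) ^ a * (\<Prod>y\<in>I. gcd_ratio w m y ^ a)" if I: "I \<in> Pow (G m)" for I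
  proof -
    have "ratio m y \<noteq> 0" if "y \<in> I" for y using ratio_gt_1[of y m] that I by force
    \<comment> \<open>The weight \<open>prod (ratio m) I\<close> clears the denominators in
      \<open>lcm_meet\<close>.\<close>
    then have "prod (ratio m) I * (\<Prod>y\<in>I. gcd_ratio w m y / ratio m y) = prod (gcd_ratio w m) I"
      by (simp add: prod.distrib[symmetric])
    moreover have "real (lcm (meet_with m I) w) = real (lcm w m) * (\<Prod>y\<in>I. gcd_ratio w m y / ratio m y)"
      using lcm_meet[OF assms(2,1)] I by (simp add: lcm.commute)
    ultimately have "prod (ratio m) I * real (lcm (meet_with m I) w)
        = real (lcm w m) * prod (gcd_ratio w m) I"
      by (simp add: mult.left_commute)
    then show ?thesis by (simp only: power_mult_distrib[symmetric] prod_power_distrib[symmetric])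
  qed
  then have "(\<Sum>I\<in>Pow (G m). (-1) ^ card I * prod (ratio m) I ^ a * real (lcm (meet_with m I) w) ^ a)
      = (\<Sum>I\<in>Pow (G m). real (lcm w m) ^ a * ((-1) ^ card I * (\<Prod>y\<in>I. gcd_ratio w m y ^ a)))"
    by (intro sum.cong) (simp_all add: mult.assoc mult.left_commute)
  also have "\<dots> = real (lcm w m) ^ a * (\<Prod>y\<in>G m. 1 - gcd_ratio w m y ^ a)"
    by (simp add: sum_distrib_left[symmetric] sum_Pow_alternating_prod[OF finite_G])
  also have "\<dots> = (if m dvd w then real w ^ a * (\<Prod>y\<in>G m. 1 - ratio m y ^ a) else 0)"
  proof (cases "m dvd w")
    case True
    have "gcd_ratio w m y = ratio m y" if "y \<in> G m" for y
    proof -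
      have "\<not> m dvd y" using G_D[OF that] S_pos[of y] by (auto dest: dvd_imp_le)
      then show ?thesis using True by (simp add: gcd_ratio_def gcd_nat.absorb2)
    qed
    then show ?thesis using True by (simp add: lcm_proj1_if_dvd)
  next
    case False
    then have "gcd w m \<noteq> m" by (metis gcd_dvd1)
    \<comment> \<open>Here \<open>gcd w m\<close> is a proper divisor of \<open>m\<close>, so some
      \<open>y\<close> above it has \<open>gcd_ratio w m y = 1\<close> and the product
      vanishes.\<close>
    then obtain y where "y \<in> G m" "gcd w m dvd y"
      using ex_G_between[of "gcd w m" m] gcd_in assms by auto
    then have "(\<Prod>y\<in>G m. 1 - gcd_ratio w m y ^ a) = 0"
      using finite_G by (intro prod_zero) (auto simp: gcd_ratio_def)
    then show ?thesis using False by simp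
  qed
  finally show ?thesis .
qed

section \<open>Divisibility of the Moebius terms\<close>

lemma alternating_sum_integral_multiple:
  fixes u a b :: nat
  defines "h \<equiv> \<lambda>w. real (lcm u w) ^ b / real w ^ a"
  assumes "u \<in> S" "m \<in> S" "b > 0" "a dvd b"
  shows "\<exists>c\<in>\<int>. (\<Sum>I\<in>Pow (G m). (-1) ^ card I * h (meet_with m I)) = c * (\<Prod>y\<in>G m. 1 - ratio m y ^ a)"
proof -
  \<comment> \<open>So \<open>j = b / a - 1\<close>, and \<open>a * j\<close> is the exponent
    \<open>b - a\<close>.\<close>
  obtain j where b: "b = a * Suc j"
    using assms(4,5) by (metis dvd_def gr0_implies_Suc nat_0_less_mult_iff)
  \<comment> \<open>Passing to the meet scales the lcm by \<open>gcd_ratio / ratio\<close> and the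
    argument by \<open>1 / ratio\<close> for each \<open>y\<close>; \<open>t y\<close> is the
    resulting change of \<open>h\<close>. The geometric sum \<open>k y\<close> is the cofactor of
    \<open>1 - ratio m y ^ a\<close> in \<open>1 - ratio m y ^ (a * j)\<close>.\<close>
  define t where "t y = gcd_ratio u m y ^ b / ratio m y ^ (a * j)" for y
  define k where "k y = (\<Sum>i<j. (ratio m y ^ a) ^ i)" for y
  define J where "J = {y \<in> G m. gcd u m dvd y}"
  have J: "J \<subseteq> G m" "finite J" using finite_G by (auto simp: J_def)
  have h_meet: "h (meet_with m I) = h m * prod t I" if I: "I \<subseteq> G m" for I
  proof -
    let ?P = "prod (ratio m) I" and ?Q = "prod (gcd_ratio u m) I"
    have P: "?P \<noteq> 0" using ratio_gt_1 I finite_subset[OF I finite_G] by fastforce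
    have "h (meet_with m I) = (real (lcm u m) * (?Q / ?P)) ^ b / (real m / ?P) ^ a"
      unfolding h_def lcm_meet[OF assms(2,3) I] meet_eq[OF assms(3) I] by (simp add: prod_dividef)
    also have "\<dots> = h m * (?Q ^ b / ?P ^ (a * j))"
      using P by (simp add: h_def b power_add power_mult_distrib power_divide field_simps)
    also have "?Q ^ b / ?P ^ (a * j) = prod t I"
      by (simp add: t_def prod_dividef prod_power_distrib)
    finally show ?thesis .
  qed
  have h_int: "h w \<in> \<int>" if "w \<in> S" for w
  proof -
    have "w ^ a dvd lcm u w ^ b"
      by (metis assms(4,5) dvd_imp_le dvd_lcm2 dvd_power_le)
    then obtain r where "lcm u w ^ b = w ^ a * r" by blast
    then have "real (lcm u w) ^ b = real w ^ a * real r"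
      by (metis of_nat_mult of_nat_power)
    then have "h w = real r" using S_pos[OF that] by (simp add: h_def)
    then show ?thesis by simp
  qed
  \<comment> \<open>The denominators \<open>p\<^sub>y ^ (b - a)\<close> of \<open>t\<^sub>y\<close>, \<open>y \<in> J\<close>, are absorbed in \<open>h m\<^sub>J\<close>, an integer since \<open>m\<^sub>J \<in> S\<close>.\<close>
  define c where "c = h (meet_with m J) * (\<Prod>y\<in>J. - k y)"
  have "c \<in> \<int>" unfolding c_def
    by (intro Ints_mult h_int meet_with_in Ints_prod)
      (auto simp: assms(3) J k_def ratio_def intro!: Ints_sum)
  have t: "1 - t y = (if y \<in> J then t y * - k y else 1) * (1 - ratio m y ^ a)" if y: "y \<in> G m" for y
  proof (cases "y \<in> J")
    case True
    define X where "X = ratio m y ^ a"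
    have "X \<noteq> 0" using ratio_gt_1[OF y] by (simp add: X_def)
    have ty: "t y = 1 / X ^ j" using True
      by (simp add: t_def J_def gcd_ratio_def X_def power_mult)
    have "1 - X ^ j = (1 - X) * k y" unfolding k_def X_def by (rule one_diff_power_eq)
    moreover have "1 - t y = - (1 - X ^ j) / X ^ j" using \<open>X \<noteq> 0\<close>
      unfolding ty by (simp add: field_simps)
    ultimately have "1 - t y = t y * - k y * (1 - X)" by (simp add: ty)
    then show ?thesis using True by (simp add: X_def)
  next
    case False
    have "ratio m y \<noteq> 0" using ratio_gt_1[OF y] by simp
    then have "t y = ratio m y ^ a" using False y
      by (simp add: t_def J_def gcd_ratio_def b power_add)
    then show ?thesis using False by simp
  qed
  have "(\<Sum>I\<in>Pow (G m). (-1) ^ card I * h (meet_with m I))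
      = (\<Sum>I\<in>Pow (G m). h m * ((-1) ^ card I * prod t I))"
    by (intro sum.cong) (auto simp: h_meet)
  also have "\<dots> = h m * (\<Prod>y\<in>G m. 1 - t y)"
    by (simp add: sum_distrib_left[symmetric] sum_Pow_alternating_prod[OF finite_G])
  also have "(\<Prod>y\<in>G m. 1 - t y)
      = (\<Prod>y\<in>G m. if y \<in> J then t y * - k y else 1) * (\<Prod>y\<in>G m. 1 - ratio m y ^ a)"
    unfolding prod.distrib[symmetric] by (intro prod.cong refl t)
  also have "(\<Prod>y\<in>G m. if y \<in> J then t y * - k y else 1) = (\<Prod>y\<in>J. t y * - k y)"
    using J finite_G by (intro prod.mono_neutral_cong_right) auto
  also have "h m * ((\<Prod>y\<in>J. t y * - k y) * (\<Prod>y\<in>G m. 1 - ratio m y ^ a))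
      = c * (\<Prod>y\<in>G m. 1 - ratio m y ^ a)"
    unfolding c_def h_meet[OF J(1)] prod.distrib by (simp only: mult.assoc)
  finally show ?thesis using \<open>c \<in> \<int>\<close> by blast
qed

text \<open>Multiplying the Moebius expansion of \<open>h\<close> by \<open>w ^ a\<close> turns its
  terms into integer multiples of the upward rows.\<close>

lemma power_row_in_row_span:
  assumes "u \<in> S" "a > 0" "b > 0" "a dvd b"
  shows "(\<lambda>w. real (lcm u w) ^ b) \<in> row_span a"
proof -
  define h where "h w = real (lcm u w) ^ b / real w ^ a" for w
  define f where "f m w = (\<Sum>I\<in>Pow (G m). (-1) ^ card I * prod (ratio m) I ^ a
    * real (lcm (meet_with m I) w) ^ a)" for m w
  have "\<forall>m\<in>S. \<exists>c\<in>\<int>. (\<Sum>I\<in>Pow (G m). (-1) ^ card I * h (meet_with m I))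
      = c * (\<Prod>y\<in>G m. 1 - ratio m y ^ a)"
    using alternating_sum_integral_multiple[OF assms(1) _ assms(3,4)] unfolding h_def by blast
  then obtain c where c: "\<And>m. m \<in> S \<Longrightarrow> c m \<in> \<int>"
    "\<And>m. m \<in> S \<Longrightarrow> (\<Sum>I\<in>Pow (G m). (-1) ^ card I * h (meet_with m I))
      = c m * (\<Prod>y\<in>G m. 1 - ratio m y ^ a)"
    by metis
  have "real (lcm u w) ^ b = (\<Sum>m\<in>S. c m * f m w)" if w: "w \<in> S" for w
  proof -
    have f_eq: "f m w = (if m dvd w then real w ^ a * (\<Prod>y\<in>G m. 1 - ratio m y ^ a) else 0)"
      if "m \<in> S" for m
      unfolding f_def by (rule upward_row_eq[OF that w assms(2)])
    have "real (lcm u w) ^ b = real w ^ a * h w"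
      using S_pos[OF w] by (simp add: h_def)
    also have "h w = (\<Sum>m\<in>{m\<in>S. m dvd w}. c m * (\<Prod>y\<in>G m. 1 - ratio m y ^ a))"
      by (subst sum_divisors_alternating[OF w]) (simp add: c)
    also have "real w ^ a * \<dots> = (\<Sum>m\<in>{m\<in>S. m dvd w}. c m * f m w)"
      unfolding sum_distrib_left by (intro sum.cong refl) (simp add: f_eq)
    \<comment> \<open>The upward row of \<open>m\<close> vanishes off the multiples of
      \<open>m\<close>, so the range of summation no longer depends on \<open>w\<close>.\<close>
    also have "\<dots> = (\<Sum>m\<in>S. c m * f m w)"
      using finite_S by (intro sum.mono_neutral_left) (auto simp: f_eq)
    finally show ?thesis .
  qed
  moreover have "(\<lambda>w. \<Sum>m\<in>S. c m * f m w) \<in> row_span a"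
    unfolding f_def
    by (intro row_span_sum row_span_scale upward_row_in_row_span finite_S c)
  ultimately show ?thesis by (simp add: row_span_def)
qed

end

section \<open>From row combinations to a left cofactor matrix\<close>

theorem theorem1p3:
  fixes n a b :: nat and x :: "nat \<Rightarrow> nat" and S :: "nat set"
  assumes "n \<ge> 1"
    and "inj_on x {..<n}"
    and "\<And>i. i < n \<Longrightarrow> x i > 0"
    and "S = x ` {..<n}"
    and "gcd_closed S"
    and "satisfies_G S"
    and "Max ((\<lambda>y. card (greatest_type_divisors S y)) ` S) = 3"
    and "a > 0" and "b > 0" and "a dvd b"
  shows "int_mat_divides n (power_lcm_mat n x a) (power_lcm_mat n x b)"
proof -
  interpret G_set S
    using assms by unfold_locales (auto simp: image_iff)
  have "\<forall>u\<in>S. \<exists>c :: nat \<Rightarrow> int. \<forall>w\<in>S.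
      real (lcm u w) ^ b = (\<Sum>z\<in>S. of_int (c z) * real (lcm z w) ^ a)"
    using power_row_in_row_span[OF _ assms(8-10)] by (simp add: row_span_def)
  then obtain c :: "nat \<Rightarrow> nat \<Rightarrow> int" where c: "\<And>u w. u \<in> S \<Longrightarrow> w \<in> S \<Longrightarrow>
      real (lcm u w) ^ b = (\<Sum>z\<in>S. of_int (c u z) * real (lcm z w) ^ a)"
    by metis
  define C where "C = mat n n (\<lambda>(i, j). c (x i) (x j))"
  have "int (lcm (x i) (x j)) ^ b = (\<Sum>k\<in>{0..<n}. c (x i) (x k) * int (lcm (x k) (x j)) ^ a)"
    if "i < n" "j < n" for i j
  proof -
    have "real_of_int (int (lcm (x i) (x j)) ^ b) = real (lcm (x i) (x j)) ^ b" by simp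
    also have "\<dots> = (\<Sum>z\<in>S. of_int (c (x i) z) * real (lcm z (x j)) ^ a)"
      using that assms(4) by (intro c) auto
    \<comment> \<open>Injectivity of \<open>x\<close> turns the sum over \<open>S\<close> into a sum
      over indices, which is an entry of a matrix product.\<close>
    also have "\<dots> = real_of_int (\<Sum>k\<in>{0..<n}. c (x i) (x k) * int (lcm (x k) (x j)) ^ a)"
      using assms(2) by (simp add: assms(4) sum.reindex lessThan_atLeast0)
    finally show ?thesis by (simp only: of_int_eq_iff)
  qed
  then have "power_lcm_mat n x b = C * power_lcm_mat n x a"
    by (intro eq_matI) (auto simp: power_lcm_mat_def C_def scalar_prod_def)
  moreover have "C \<in> carrier_mat n n" by (simp add: C_def)
  ultimately show ?thesis
    by (auto simp: int_mat_divides_def power_lcm_mat_def)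
qed

end
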